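(* Let $n\ge 1$, let $M:\mathbb{R}^n\to\mathbb{R}^{n\times n}$ be a continuously differentiable mass matrix with $M(q)$ symmetric positive definite for every $q$, let $J,K,D\in\mathbb{R}^{n\times n}$ be constant symmetric positive definite matrices, and let $V:\mathbb{R}^n\to\mathbb{R}$ be a differentiable potential. Consider the system with state $(q,\theta,p,s)\in(\mathbb{R}^n)^4$ and inputs $\tau_e,\tau\in\mathbb{R}^n$, $$\dot q=M^{-1}(q)p,\qquad \dot\theta=J^{-1}s,$$ $$\dot p=-\nabla_qV(q)+K(\theta-q)+D(J^{-1}s-M^{-1}(q)p)-\tfrac12\nabla_q\big(p^\top M^{-1}(q)p\big)+\tau_e,$$ $$\dot s=-K(\theta-q)-D(J^{-1}s-M^{-1}(q)p)+\tau .$$ Let $J_e,K_e\in\mathbb{R}^{n\times n}$ be any constant symmetric positive definite matrices such that $D_e:=DK^{-1}K_e$ is symmetric and positive definite. Define $$K_F=-JK^{-1}(K_e-K)M^{-1}(q),\qquad K_G=JK^{-1}K_eJ_e^{-1}-K_F-I_n,\qquad K_H=JK^{-1}K_eJ_e^{-1},$$ and close the loop with the control law $$\tau=K_F\,\tau_e-K_G\,\tau_a-K_F\,C(q,\dot q)\,\dot q-K_F\nabla_qV(q)+K_H\,\tau_u,\qquad \tau_a=K(\theta-q)+D(\dot\theta-\dot q),$$ where $C(q,\dot q)$ is the Coriolis matrix associated with $M$ and $\tau_u\in\mathbb{R}^n$ is a new external input. Then: (i) In the coordinates $(q,\varphi,p,z)$ obtained from $(q,\theta,p,s)$ by the transformation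 $$\varphi=K_e^{-1}(K_e-K)q+K_e^{-1}K\theta,\qquad z=J_eK_e^{-1}(K_e-K)M^{-1}(q)p+J_eK_e^{-1}KJ^{-1}s,$$ the closed-loop dynamics takes the port-Hamiltonian form $$\begin{bmatrix}\dot q\\ \dot\varphi\\ \dot p\\ \dot z\end{bmatrix}=\begin{bmatrix}0&0&I_n&0\\0&0&0&I_n\\-I_n&0&-D_e&D_e\\0&-I_n&D_e&-D_e\end{bmatrix}\nabla H_{\mathrm{NCL}}(q,\varphi,p,z)+\begin{bmatrix}0\\0\\ \tau_e\\ \tau_u\end{bmatrix},$$ with $$H_{\mathrm{NCL}}(q,\varphi,p,z)=\tfrac12p^\top M^{-1}(q)p+\tfrac12z^\top J_e^{-1}z+\tfrac12(\varphi-q)^\top K_e(\varphi-q)+V(q).$$ (ii) The closed loop is passive with inputs $(\tau_e,\tau_u)$, outputs $(\dot q,\dot\varphi)$ and storage function $H_{\mathrm{NCL}}$.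
   Context: All zero blocks are $n\times n$ (or $n\times 1$ in the input vector), and $\nabla H_{\mathrm{NCL}}=(\nabla_qH_{\mathrm{NCL}},\nabla_\varphi H_{\mathrm{NCL}},\nabla_pH_{\mathrm{NCL}},\nabla_zH_{\mathrm{NCL}})$ is the column of partial gradients. In $\nabla_q(p^\top M^{-1}(q)p)$ the gradient is taken with $p$ held fixed. The system models a flexible-joint robot with link positions $q$, motor positions $\theta$, momenta $p=M(q)\dot q$, $s=J\dot\theta$, motor inertia $J$, joint stiffness $K$, joint damping $D$, gravity potential $V$, environmental force $\tau_e$ and actuator force $\tau$; equivalently $M(q)\ddot q+C(q,\dot q)\dot q-K(\theta-q)-D(\dot\theta-\dot q)+\nabla_qV(q)=\tau_e$ and $J\ddot\theta+K(\theta-q)+D(\dot\theta-\dot q)=\tau$. The Coriolis matrix $C(q,\dot q)\in\mathbb{R}^{n\times n}$ is the standard one from the Euler-Lagrange equations of $\frac12\dot q^\top M(q)\dot q$, so that $C(q,\dot q)\dot q=\dot M(q)\dot q-\frac12\nabla_q\big(\dot q^\top M(q)\dot q\big)$, where $\dot M(q)=\sum_i \frac{\partial M}{\partial q_i}(q)\,\dot q_i$ and the gradient is taken with $\dot q$ held fixed. A system with state $x$ is called passive with inputs $(\tau_e,\tau_u)$, outputs $(\dot q,\dot\varphi)$ and storage function $H$ if, along every solution and for all input signals, $\frac{d}{dt}H(x(t))\le \dot q^\top\tau_e+\dot\varphi^\top\tau_u$. *)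

theory Defs
  imports "HOL-Analysis.Analysis"
begin

text \<open>Gradient with respect to the inner product; arbitrary where \<^term>\<open>f\<close> is not differentiable.\<close>

definition grad :: "('a::real_inner \<Rightarrow> real) \<Rightarrow> 'a \<Rightarrow> 'a" where
  "grad f x = (THE g. GDERIV f x :> g)"

definition partial_derivative ::
  "'n::finite \<Rightarrow> (real^'n \<Rightarrow> 'b::real_normed_vector) \<Rightarrow> real^'n \<Rightarrow> 'b" where
  "partial_derivative i f x = vector_derivative (\<lambda>t. f (x + t *\<^sub>R axis i 1)) (at 0)"

definition continuously_differentiable ::
  "('a::real_normed_vector \<Rightarrow> 'b::real_normed_vector) \<Rightarrow> bool" where
  "continuously_differentiable f \<longleftrightarrow>
     (\<exists>f'. (\<forall>x. (f has_derivative blinfun_apply (f' x)) (at x)) \<and> continuous_on UNIV f')"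

definition C1_diffeomorphism ::
  "('a::real_normed_vector \<Rightarrow> 'b::real_normed_vector) \<Rightarrow> bool" where
  "C1_diffeomorphism f \<longleftrightarrow>
     bij f \<and> continuously_differentiable f \<and> continuously_differentiable (inv f)"

definition sym_pos_def :: "real^'n^'n \<Rightarrow> bool" where
  "sym_pos_def A \<longleftrightarrow> transpose A = A \<and> (\<forall>x. x \<noteq> 0 \<longrightarrow> x \<bullet> (A *v x) > 0)"

definition time_interval :: "real set \<Rightarrow> bool" where
  "time_interval T \<longleftrightarrow> is_interval T \<and> interior T \<noteq> {}"

text \<open>A control system is given by its right-hand side \<^term>\<open>f\<close>, taking the input value and the
  state. Derivatives are one-sided at endpoints of \<^term>\<open>T\<close> belonging to \<^term>\<open>T\<close>.\<close>

definition solution_on ::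
  "real set \<Rightarrow> ('u \<Rightarrow> 'x \<Rightarrow> 'x) \<Rightarrow> (real \<Rightarrow> 'u) \<Rightarrow> (real \<Rightarrow> 'x::real_normed_vector) \<Rightarrow> bool" where
  "solution_on T f u x \<longleftrightarrow>
     (\<forall>t\<in>T. (x has_vector_derivative f (u t) (x t)) (at t within T))"

text \<open>The output is the velocity, along the solution, of the position-like function \<^term>\<open>r\<close> of the
  state. On a time interval the two derivatives below are unique.\<close>

definition passive_with ::
  "('u \<Rightarrow> 'x \<Rightarrow> 'x::real_normed_vector) \<Rightarrow> ('x \<Rightarrow> 'u::real_inner) \<Rightarrow> ('x \<Rightarrow> real) \<Rightarrow> bool" where
  "passive_with f r H \<longleftrightarrow>
     (\<forall>T u x. time_interval T \<longrightarrow> solution_on T f u x \<longrightarrow>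
        (\<forall>t\<in>T. \<exists>h y.
           ((\<lambda>t. H (x t)) has_real_derivative h) (at t within T) \<and>
           ((\<lambda>t. r (x t)) has_vector_derivative y) (at t within T) \<and>
           h \<le> y \<bullet> u t))"

definition mass_derivative :: "(real^'n \<Rightarrow> real^'n^'n) \<Rightarrow> real^'n \<Rightarrow> real^'n \<Rightarrow> real^'n^'n" where
  "mass_derivative M q v = (\<Sum>i\<in>UNIV. v $ i *\<^sub>R partial_derivative i M q)"

text \<open>A Coriolis matrix is not unique; only its product with the velocity is. The usual choice by
  Christoffel symbols is shown below to be an instance.\<close>

definition coriolis_matrix ::
  "(real^'n \<Rightarrow> real^'n^'n) \<Rightarrow> (real^'n \<Rightarrow> real^'n \<Rightarrow> real^'n^'n) \<Rightarrow> bool" where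
  "coriolis_matrix M C \<longleftrightarrow>
     (\<forall>q v. C q v *v v =
        mass_derivative M q v *v v - (1/2) *\<^sub>R grad (\<lambda>q. v \<bullet> (M q *v v)) q)"

definition christoffel_coriolis ::
  "(real^'n \<Rightarrow> real^'n^'n) \<Rightarrow> real^'n \<Rightarrow> real^'n \<Rightarrow> real^'n^'n" where
  "christoffel_coriolis M q v =
     (\<chi> i j. \<Sum>k\<in>UNIV. (1/2) *
        (partial_derivative k M q $ i $ j + partial_derivative j M q $ i $ k
         - partial_derivative i M q $ j $ k) * v $ k)"

lemma grad_eq:
  assumes "GDERIV f x :> g"
  shows "grad f x = g"
  unfolding grad_def
proof (rule the_equality)
  show "GDERIV f x :> g" by (rule assms)
next
  fix g' assume "GDERIV f x :> g'"
  then have "(\<lambda>h. h \<bullet> g') = (\<lambda>h. h \<bullet> g)"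
    using assms unfolding gderiv_def by (rule has_derivative_unique)
  then have "\<forall>h. h \<bullet> g' = h \<bullet> g" by metis
  then show "g' = g" using vector_eq_ldot[of g' g] by (simp add: inner_commute)
qed

lemma partial_derivative_eq:
  assumes "(f has_derivative f') (at x)"
  shows "partial_derivative i f x = f' (axis i 1)"
proof -
  have 1: "((\<lambda>t::real. x + t *\<^sub>R axis i 1) has_derivative (\<lambda>t. t *\<^sub>R axis i 1)) (at 0)"
    by (auto intro!: derivative_eq_intros)
  have 2: "(f has_derivative f') (at (x + 0 *\<^sub>R axis i 1))"
    using assms by simp
  have "((\<lambda>t. f (x + t *\<^sub>R axis i 1)) has_derivative (\<lambda>t. f' (t *\<^sub>R axis i 1))) (at 0)"
    using has_derivative_compose[OF 1 2] .
  moreover have "f' (t *\<^sub>R axis i 1) = t *\<^sub>R f' (axis i 1)" for t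
    using assms by (simp add: has_derivative_linear linear_cmul)
  ultimately show ?thesis
    unfolding partial_derivative_def
    by (intro vector_derivative_at) (simp add: has_vector_derivative_def)
qed

lemma coriolis_matrix_christoffel:
  fixes M :: "real^'n \<Rightarrow> real^'n^'n"
  assumes "continuously_differentiable M"
  shows "coriolis_matrix M (christoffel_coriolis M)"
  unfolding coriolis_matrix_def
proof (intro allI)
  fix q v :: "real^'n"
  obtain M' where M': "(M has_derivative M') (at q)"
    using assms unfolding continuously_differentiable_def by blast
  define P where "P i = partial_derivative i M q" for i
  have P: "P i = M' (axis i 1)" for i
    unfolding P_def by (rule partial_derivative_eq[OF M'])
  have lin: "linear M'" using M' by (rule has_derivative_linear)
  have bl: "bounded_linear (\<lambda>A::real^'n^'n. v \<bullet> (A *v v))"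
  proof -
    have "linear (\<lambda>A::real^'n^'n. v \<bullet> (A *v v))"
      by (rule linearI)
         (simp_all add: matrix_vector_mult_add_rdistrib inner_right_distrib
           scaleR_matrix_vector_assoc[symmetric])
    then show ?thesis by (rule linear_conv_bounded_linear[THEN iffD1])
  qed
  have d: "((\<lambda>q. v \<bullet> (M q *v v)) has_derivative (\<lambda>h. v \<bullet> (M' h *v v))) (at q)"
    by (rule bounded_linear.has_derivative[OF bl M'])
  have M'_sum: "M' h = (\<Sum>i\<in>UNIV. h $ i *\<^sub>R P i)" for h
  proof -
    have "M' h = M' (\<Sum>i\<in>UNIV. h $ i *\<^sub>R axis i 1)"
      by (metis basis_expansion scalar_mult_eq_scaleR)
    also have "\<dots> = (\<Sum>i\<in>UNIV. h $ i *\<^sub>R M' (axis i 1))"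
      by (simp add: linear_sum[OF lin] linear_cmul[OF lin])
    finally show ?thesis by (simp add: P)
  qed
  have "v \<bullet> (M' h *v v) = h \<bullet> (\<chi> i. v \<bullet> (P i *v v))" for h
  proof -
    interpret L: bounded_linear "\<lambda>A::real^'n^'n. v \<bullet> (A *v v)" by (rule bl)
    show ?thesis
      by (simp add: M'_sum L.sum L.scaleR inner_vec_def[of h])
  qed
  then have g: "grad (\<lambda>q. v \<bullet> (M q *v v)) q = (\<chi> i. v \<bullet> (P i *v v))"
    using d by (intro grad_eq) (simp add: gderiv_def)
  show "christoffel_coriolis M q v *v v =
      mass_derivative M q v *v v - (1/2) *\<^sub>R grad (\<lambda>q. v \<bullet> (M q *v v)) q"
  proof (simp only: g vec_eq_iff, intro allI)
    fix i
    have A: "(christoffel_coriolis M q v *v v) $ i =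
        (1/2) * (\<Sum>j\<in>UNIV. \<Sum>k\<in>UNIV. P k $ i $ j * v $ k * v $ j)
        + (1/2) * (\<Sum>j\<in>UNIV. \<Sum>k\<in>UNIV. P j $ i $ k * v $ k * v $ j)
        - (1/2) * (\<Sum>j\<in>UNIV. \<Sum>k\<in>UNIV. P i $ j $ k * v $ k * v $ j)"
      unfolding christoffel_coriolis_def P_def[symmetric]
      by (simp add: matrix_vector_mult_def sum_distrib_left sum_distrib_right
          sum.distrib[symmetric] sum_subtractf[symmetric] algebra_simps diff_divide_distrib add_divide_distrib)
    have B: "(\<Sum>j\<in>UNIV. \<Sum>k\<in>UNIV. P j $ i $ k * v $ k * v $ j)
        = (\<Sum>j\<in>UNIV. \<Sum>k\<in>UNIV. P k $ i $ j * v $ k * v $ j)"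
      by (subst sum.swap) (simp add: mult_ac)
    have E: "(mass_derivative M q v *v v) $ i
        = (\<Sum>j\<in>UNIV. \<Sum>k\<in>UNIV. P k $ i $ j * v $ k * v $ j)"
      unfolding mass_derivative_def P_def[symmetric]
      by (simp add: matrix_vector_mult_def sum_distrib_right sum_distrib_left mult_ac)
    have G: "v \<bullet> (P i *v v) = (\<Sum>j\<in>UNIV. \<Sum>k\<in>UNIV. P i $ j $ k * v $ k * v $ j)"
      by (simp add: inner_vec_def matrix_vector_mult_def sum_distrib_left mult_ac)
    show "(christoffel_coriolis M q v *v v) $ i =
        (mass_derivative M q v *v v - (1/2) *\<^sub>R (\<chi> i. v \<bullet> (P i *v v))) $ i"
      by (simp add: A B E G)
  qed
qed

type_synonym 'n state4 = "(real^'n) \<times> (real^'n) \<times> (real^'n) \<times> (real^'n)"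

fun plant ::
  "(real^'n \<Rightarrow> real^'n^'n) \<Rightarrow> real^'n^'n \<Rightarrow> real^'n^'n \<Rightarrow> real^'n^'n \<Rightarrow> (real^'n \<Rightarrow> real) \<Rightarrow>
   (real^'n) \<times> (real^'n) \<Rightarrow> 'n state4 \<Rightarrow> 'n state4" where
  "plant M J K D V (\<tau>e, \<tau>) (q, \<theta>, p, s) =
     (matrix_inv (M q) *v p,
      matrix_inv J *v s,
      - grad V q + K *v (\<theta> - q) + D *v (matrix_inv J *v s - matrix_inv (M q) *v p)
        - (1/2) *\<^sub>R grad (\<lambda>q. p \<bullet> (matrix_inv (M q) *v p)) q + \<tau>e,
      - (K *v (\<theta> - q)) - D *v (matrix_inv J *v s - matrix_inv (M q) *v p) + \<tau>)"

definition gain_F ::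
  "(real^'n \<Rightarrow> real^'n^'n) \<Rightarrow> real^'n^'n \<Rightarrow> real^'n^'n \<Rightarrow> real^'n^'n \<Rightarrow> real^'n \<Rightarrow> real^'n^'n" where
  "gain_F M J K Ke q = - (J ** matrix_inv K ** (Ke - K) ** matrix_inv (M q))"

definition gain_H ::
  "real^'n^'n \<Rightarrow> real^'n^'n \<Rightarrow> real^'n^'n \<Rightarrow> real^'n^'n \<Rightarrow> real^'n^'n" where
  "gain_H J K Je Ke = J ** matrix_inv K ** Ke ** matrix_inv Je"

definition gain_G ::
  "(real^'n \<Rightarrow> real^'n^'n) \<Rightarrow> real^'n^'n \<Rightarrow> real^'n^'n \<Rightarrow> real^'n^'n \<Rightarrow> real^'n^'n \<Rightarrow>
   real^'n \<Rightarrow> real^'n^'n" where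
  "gain_G M J K Je Ke q =
     J ** matrix_inv K ** Ke ** matrix_inv Je - gain_F M J K Ke q - mat 1"

definition control_law ::
  "(real^'n \<Rightarrow> real^'n^'n) \<Rightarrow> (real^'n \<Rightarrow> real^'n \<Rightarrow> real^'n^'n) \<Rightarrow>
   real^'n^'n \<Rightarrow> real^'n^'n \<Rightarrow> real^'n^'n \<Rightarrow> (real^'n \<Rightarrow> real) \<Rightarrow> real^'n^'n \<Rightarrow> real^'n^'n \<Rightarrow>
   real^'n \<Rightarrow> real^'n \<Rightarrow> real^'n \<Rightarrow> real^'n \<Rightarrow> real^'n \<Rightarrow> real^'n \<Rightarrow> real^'n" where
  "control_law M C J K D V Je Ke \<tau>e \<tau>u q \<theta> q_dot \<theta>_dot =
     (let \<tau>a = K *v (\<theta> - q) + D *v (\<theta>_dot - q_dot);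
          KF = gain_F M J K Ke q; KG = gain_G M J K Je Ke q; KH = gain_H J K Je Ke
      in KF *v \<tau>e - KG *v \<tau>a - KF *v (C q q_dot *v q_dot) - KF *v grad V q + KH *v \<tau>u)"

text \<open>The velocities fed to the controller are those of the plant, which do not
  depend on \<open>\<tau>\<close>.\<close>

fun closed_loop ::
  "(real^'n \<Rightarrow> real^'n^'n) \<Rightarrow> (real^'n \<Rightarrow> real^'n \<Rightarrow> real^'n^'n) \<Rightarrow>
   real^'n^'n \<Rightarrow> real^'n^'n \<Rightarrow> real^'n^'n \<Rightarrow> (real^'n \<Rightarrow> real) \<Rightarrow> real^'n^'n \<Rightarrow> real^'n^'n \<Rightarrow>
   (real^'n) \<times> (real^'n) \<Rightarrow> 'n state4 \<Rightarrow> 'n state4" where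
  "closed_loop M C J K D V Je Ke (\<tau>e, \<tau>u) (q, \<theta>, p, s) =
     plant M J K D V
       (\<tau>e, control_law M C J K D V Je Ke \<tau>e \<tau>u q \<theta> (matrix_inv (M q) *v p) (matrix_inv J *v s))
       (q, \<theta>, p, s)"

fun coord_change ::
  "(real^'n \<Rightarrow> real^'n^'n) \<Rightarrow> real^'n^'n \<Rightarrow> real^'n^'n \<Rightarrow> real^'n^'n \<Rightarrow> real^'n^'n \<Rightarrow>
   'n state4 \<Rightarrow> 'n state4" where
  "coord_change M J K Je Ke (q, \<theta>, p, s) =
     (q,
      (matrix_inv Ke ** (Ke - K)) *v q + (matrix_inv Ke ** K) *v \<theta>,
      p,
      (Je ** matrix_inv Ke ** (Ke - K) ** matrix_inv (M q)) *v p
        + (Je ** matrix_inv Ke ** K ** matrix_inv J) *v s)"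

fun H_NCL ::
  "(real^'n \<Rightarrow> real^'n^'n) \<Rightarrow> (real^'n \<Rightarrow> real) \<Rightarrow> real^'n^'n \<Rightarrow> real^'n^'n \<Rightarrow> 'n state4 \<Rightarrow> real" where
  "H_NCL M V Je Ke (q, \<phi>, p, z) =
     (1/2) * (p \<bullet> (matrix_inv (M q) *v p)) + (1/2) * (z \<bullet> (matrix_inv Je *v z))
     + (1/2) * ((\<phi> - q) \<bullet> (Ke *v (\<phi> - q))) + V q"

fun nabla4 :: "('n::finite state4 \<Rightarrow> real) \<Rightarrow> 'n state4 \<Rightarrow> 'n state4" where
  "nabla4 H (q, \<phi>, p, z) =
     (grad (\<lambda>q. H (q, \<phi>, p, z)) q,
      grad (\<lambda>\<phi>. H (q, \<phi>, p, z)) \<phi>,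
      grad (\<lambda>p. H (q, \<phi>, p, z)) p,
      grad (\<lambda>z. H (q, \<phi>, p, z)) z)"

type_synonym 'n block_row = "(real^'n^'n) \<times> (real^'n^'n) \<times> (real^'n^'n) \<times> (real^'n^'n)"

fun block_row_mult :: "'n::finite block_row \<Rightarrow> 'n state4 \<Rightarrow> real^'n" where
  "block_row_mult (A, B, C, D) (a, b, c, d) = A *v a + B *v b + C *v c + D *v d"

fun block_mult ::
  "'n::finite block_row \<times> 'n block_row \<times> 'n block_row \<times> 'n block_row \<Rightarrow> 'n state4 \<Rightarrow> 'n state4" where
  "block_mult (R1, R2, R3, R4) x =
     (block_row_mult R1 x, block_row_mult R2 x, block_row_mult R3 x, block_row_mult R4 x)"

fun port_hamiltonian ::
  "real^'n^'n \<Rightarrow> ('n state4 \<Rightarrow> real) \<Rightarrow> (real^'n) \<times> (real^'n) \<Rightarrow> 'n state4 \<Rightarrow> 'n state4" where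
  "port_hamiltonian De H (\<tau>e, \<tau>u) x =
     block_mult
       ((0,        0,        mat 1, 0),
        (0,        0,        0,     mat 1),
        (- mat 1,  0,        - De,  De),
        (0,        - mat 1,  De,    - De))
       (nabla4 H x)
     + (0, 0, \<tau>e, \<tau>u)"

fun position_pair :: "'n::finite state4 \<Rightarrow> (real^'n) \<times> (real^'n)" where
  "position_pair (q, \<phi>, p, z) = (q, \<phi>)"

end

theory Submission imports Defs begin

text \<open>The transformation reads \<open>\<phi> - q = K\<^sub>e\<^sup>-\<^sup>1 K (\<theta> - q)\<close> and \<open>z = J\<^sub>e \<phi>'\<close>, so the spring force and
  the damping force are the same in both coordinate systems. With \<open>p = M(q) v\<close> held fixed instead of
  \<open>v\<close>, the gradient of the kinetic energy changes sign; hence the momentum equation yields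
  \<open>v' = M\<^sup>-\<^sup>1 (\<tau>\<^sub>e + \<tau>\<^sub>a - C v - \<nabla>V)\<close>, and the control law is chosen such that \<open>z' = \<tau>\<^sub>u - \<tau>\<^sub>a\<close>.\<close>

section \<open>Symmetric positive definite matrices and their inverses\<close>

lemma invertible_sym_pos_def:
  fixes A :: "real^'n^'n"
  assumes "sym_pos_def A"
  shows "invertible A"
proof -
  have "\<forall>x. A *v x = 0 \<longrightarrow> x = 0"
    using assms unfolding sym_pos_def_def by (metis inner_zero_right less_irrefl)
  then show ?thesis
    by (simp add: invertible_left_inverse matrix_left_invertible_ker)
qed

lemma matrix_inv_mult:
  fixes A :: "real^'n^'n"
  assumes "invertible A"
  shows "A ** matrix_inv A = mat 1" "matrix_inv A ** A = mat 1"
proof -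
  have "A ** matrix_inv A = mat 1 \<and> matrix_inv A ** A = mat 1"
    using assms unfolding invertible_def matrix_inv_def by (rule someI_ex)
  then show "A ** matrix_inv A = mat 1" "matrix_inv A ** A = mat 1" by auto
qed

lemma sym_pos_def_cancel [simp]:
  fixes A :: "real^'n^'n"
  assumes "sym_pos_def A"
  shows "A *v (matrix_inv A *v x) = x" "matrix_inv A *v (A *v x) = x"
  using matrix_inv_mult[OF invertible_sym_pos_def[OF assms]]
  by (simp_all add: matrix_vector_mul_assoc)

lemma sym_pos_def_inner:
  fixes A :: "real^'n^'n"
  assumes "sym_pos_def A"
  shows "(A *v x) \<bullet> y = x \<bullet> (A *v y)"
  using assms unfolding sym_pos_def_def
  by (metis dot_lmul_matrix transpose_matrix_vector)

lemma sym_pos_def_inv_inner: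
  fixes A :: "real^'n^'n"
  assumes "sym_pos_def A"
  shows "(matrix_inv A *v x) \<bullet> y = x \<bullet> (matrix_inv A *v y)"
  using sym_pos_def_inner[OF assms, of "matrix_inv A *v x" "matrix_inv A *v y"] assms
  by simp

section \<open>Calculus of matrix-valued functions\<close>

text \<open>In finite dimension algebraic bilinearity suffices. Boundedness then supplies the
  product and continuity rules collected below.\<close>

lemma bounded_bilinear_matrix_vector_mult:
  "bounded_bilinear (\<lambda>(A::real^'n^'m) x. A *v x)"
  unfolding bilinear_conv_bounded_bilinear[symmetric] bilinear_def
  by (auto intro!: linearI simp: matrix_vector_right_distrib matrix_vector_mult_add_rdistrib
      matrix_vector_mult_scaleR scaleR_matrix_vector_assoc[symmetric])

lemma bounded_bilinear_matrix_matrix_mult: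
  "bounded_bilinear (\<lambda>(A::real^'n^'m) (B::real^'k^'n). A ** B)"
  unfolding bilinear_conv_bounded_bilinear[symmetric] bilinear_def
  by (auto intro!: linearI simp: vec_eq_iff matrix_matrix_mult_def sum.distrib
      sum_distrib_left distrib_left distrib_right mult.assoc mult.left_commute)

lemmas matrix_vector_mult_minus =
  bounded_bilinear.minus_left[OF bounded_bilinear_matrix_vector_mult]
  bounded_bilinear.minus_right[OF bounded_bilinear_matrix_vector_mult]

lemmas has_derivative_matrix_vector_mult =
  bounded_bilinear.FDERIV[OF bounded_bilinear_matrix_vector_mult]
lemmas has_derivative_matrix_matrix_mult =
  bounded_bilinear.FDERIV[OF bounded_bilinear_matrix_matrix_mult]
lemmas continuous_on_matrix_vector_mult =
  bounded_bilinear.continuous_on[OF bounded_bilinear_matrix_vector_mult]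
lemmas continuous_on_matrix_matrix_mult =
  bounded_bilinear.continuous_on[OF bounded_bilinear_matrix_matrix_mult]

lemma differentiable_vec_iff:
  fixes f :: "'a::real_normed_vector \<Rightarrow> 'b::euclidean_space^'n"
  shows "f differentiable (at x within S) \<longleftrightarrow> (\<forall>i. (\<lambda>x. f x $ i) differentiable (at x within S))"
proof
  assume "f differentiable (at x within S)"
  then show "\<forall>i. (\<lambda>x. f x $ i) differentiable (at x within S)"
    using bounded_linear.has_derivative[OF bounded_linear_vec_nth]
    unfolding differentiable_def by blast
next
  assume *: "\<forall>i. (\<lambda>x. f x $ i) differentiable (at x within S)"
  show "f differentiable (at x within S)"
    unfolding differentiable_componentwise_within[of f]
  proof
    fix b :: "'b^'n" assume "b \<in> Basis"
    then obtain i c where b: "b = axis i c" by (auto simp: Basis_vec_def)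
    show "(\<lambda>x. f x \<bullet> b) differentiable (at x within S)"
      using * by (simp add: b inner_axis differentiable_inner)
  qed
qed

lemma differentiable_det:
  fixes A :: "'a::real_normed_vector \<Rightarrow> real^'n^'n"
  assumes "\<And>i j. (\<lambda>x. A x $ i $ j) differentiable (at x within S)"
  shows "(\<lambda>x. det (A x)) differentiable (at x within S)"
proof -
  have prod: "(\<lambda>x. \<Prod>i\<in>I. f i x) differentiable (at x within S)"
    if "\<And>i. f i differentiable (at x within S)" for f :: "'n \<Rightarrow> 'a \<Rightarrow> real" and I
    using has_derivative_prod[of I f _ x S] that unfolding differentiable_def by metis
  show ?thesis
    unfolding det_def
    by (rule differentiable_sum, simp)
       (intro ballI differentiable_mult differentiable_const prod assms)
qed

text \<open>By Cramer's rule each entry of the inverse is a quotient of two determinants. These are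
  polynomials in the entries of \<open>A y\<close> and the right-hand side, and the denominator
  never vanishes.\<close>

lemma differentiable_matrix_inv:
  fixes A :: "'a::real_normed_vector \<Rightarrow> real^'n^'n"
  assumes "A differentiable (at x within S)" "\<And>y. invertible (A y)"
  shows "(\<lambda>y. matrix_inv (A y)) differentiable (at x within S)"
proof -
  have ent: "(\<lambda>y. A y $ i $ j) differentiable (at x within S)" for i j
    using assms(1) by (simp add: differentiable_vec_iff)
  have det: "det (A y) \<noteq> 0" for y
    using assms(2) by (simp add: invertible_det_nz)
  have inv: "matrix_inv (A y) $ k $ l
      = det (\<chi> i j. if j = k then axis l 1 $ i else A y $ i $ j) / det (A y)" for y k l
  proof -
    \<comment> \<open>Column \<open>l\<close> of the inverse solves the linear system with
      right-hand side \<open>axis l 1\<close>.\<close>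
    have "A y *v (matrix_inv (A y) *v axis l 1) = axis l 1"
      using matrix_inv_mult[OF assms(2)] by (simp add: matrix_vector_mul_assoc)
    then have "matrix_inv (A y) *v axis l 1
        = (\<chi> k. det (\<chi> i j. if j = k then axis l 1 $ i else A y $ i $ j) / det (A y))"
      using cramer[OF det] by blast
    then show ?thesis
      by (metis (no_types, lifting) column_def matrix_vector_mul_component matrix_vector_mult_basis
          vec_lambda_beta)
  qed
  have num: "(\<lambda>y. det (\<chi> i j. if j = k then axis l 1 $ i else A y $ i $ j))
      differentiable (at x within S)" for k and l :: 'n
  proof (rule differentiable_det)
    fix i j
    show "(\<lambda>y. (\<chi> i j. if j = k then axis l 1 $ i else A y $ i $ j) $ i $ j)
        differentiable (at x within S)"
      using ent by (cases "j = k") simp_all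
  qed
  show ?thesis
    by (simp add: differentiable_vec_iff inv)
       (intro allI differentiable_divide num differentiable_det ent det)
qed

text \<open>Once the inverse is known to be differentiable, the product rule applied to the constant
  \<open>matrix_inv (A y) ** A y\<close> gives an equation that is solved for the derivative
  \<open>B h\<close>.\<close>

lemma has_derivative_matrix_inv:
  fixes A :: "'a::real_normed_vector \<Rightarrow> real^'n^'n"
  assumes "(A has_derivative A') (at x)" "\<And>y. invertible (A y)"
  shows "((\<lambda>y. matrix_inv (A y)) has_derivative
      (\<lambda>h. - (matrix_inv (A x) ** A' h ** matrix_inv (A x)))) (at x)"
proof -
  obtain B where B: "((\<lambda>y. matrix_inv (A y)) has_derivative B) (at x)"
    using differentiable_matrix_inv[of A x UNIV] assms unfolding differentiable_def by blast
  have product: "((\<lambda>y. matrix_inv (A y) ** A y) has_derivative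
      (\<lambda>h. matrix_inv (A x) ** A' h + B h ** A x)) (at x)"
    by (rule has_derivative_matrix_matrix_mult[OF B assms(1)])
  have const: "((\<lambda>y. matrix_inv (A y) ** A y) has_derivative (\<lambda>h. 0)) (at x)"
    by (simp add: matrix_inv_mult assms(2))
  have eq: "B h ** A x = - (matrix_inv (A x) ** A' h)" for h
    using fun_cong[OF has_derivative_unique[OF product const], of h] by (simp add: add_eq_0_iff)
  interpret bounded_bilinear "\<lambda>(A::real^'n^'n) (B::real^'n^'n). A ** B"
    by (rule bounded_bilinear_matrix_matrix_mult)
  have "B h = - (matrix_inv (A x) ** A' h ** matrix_inv (A x))" for h
  proof -
    have "B h = (B h ** A x) ** matrix_inv (A x)"
      by (simp add: matrix_mul_assoc[symmetric] matrix_inv_mult assms(2))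
    then show ?thesis by (simp add: eq minus_left)
  qed
  then have "B = (\<lambda>h. - (matrix_inv (A x) ** A' h ** matrix_inv (A x)))" by blast
  with B show ?thesis by simp
qed

section \<open>Continuous differentiability and gradients\<close>

text \<open>On a finite-dimensional domain, continuity of the derivative in operator norm follows
  from continuity in each fixed direction \<open>h\<close>.\<close>

lemma continuously_differentiableI:
  fixes f :: "'a::euclidean_space \<Rightarrow> 'b::real_normed_vector"
  assumes "\<And>x. (f has_derivative f' x) (at x)" "\<And>h. continuous_on UNIV (\<lambda>x. f' x h)"
  shows "continuously_differentiable f"
proof -
  have "blinfun_apply (Blinfun (f' x)) = f' x" for x
    using assms(1) by (intro bounded_linear_Blinfun_apply has_derivative_bounded_linear)
  then show ?thesis
    unfolding continuously_differentiable_def using assms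
    by (intro exI[of _ "\<lambda>x. Blinfun (f' x)"]) (auto intro: continuous_on_blinfun_componentwise)
qed

text \<open>The derivative is a linear functional, represented by the vector
  \<open>adjoint f' 1\<close>; so the definite description in \<open>grad\<close> denotes an actual
  gradient.\<close>

lemma GDERIV_grad:
  fixes f :: "'a::euclidean_space \<Rightarrow> real"
  assumes "f differentiable (at x)"
  shows "GDERIV f x :> grad f x"
proof -
  obtain f' where f': "(f has_derivative f') (at x)"
    using assms unfolding differentiable_def by blast
  have "f' h = h \<bullet> adjoint f' 1" for h
    using adjoint_works[OF has_derivative_linear[OF f'], of h 1] by simp
  then have "f' = (\<lambda>h. h \<bullet> adjoint f' 1)" by blast
  with f' have "GDERIV f x :> adjoint f' 1" by (simp add: gderiv_def)
  then show ?thesis using grad_eq by metis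
qed

lemma has_derivative_quadratic_form:
  fixes A :: "real^'n^'n"
  assumes "\<And>x y. (A *v x) \<bullet> y = x \<bullet> (A *v y)"
    and "(f has_derivative f') (at x within S)"
  shows "((\<lambda>x. (1/2) * (f x \<bullet> (A *v f x))) has_derivative (\<lambda>h. f' h \<bullet> (A *v f x))) (at x within S)"
proof -
  have "((\<lambda>x. A *v f x) has_derivative (\<lambda>h. A *v f' h)) (at x within S)"
    by (rule bounded_linear.has_derivative[OF matrix_vector_mul_bounded_linear assms(2)])
  note has_derivative_mult_right[OF has_derivative_inner[OF assms(2) this], of "1/2"]
  moreover have "f x \<bullet> (A *v f' h) = f' h \<bullet> (A *v f x)" for h
    using assms(1) by (metis inner_commute)
  ultimately show ?thesis by simp
qed

text \<open>The inner product of a product space is the sum over its components. Restricting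
  \<open>H\<close> to one slot therefore picks out one component of the full gradient.\<close>

lemma nabla4_eq:
  assumes "GDERIV H (q, \<phi>, p, z) :> (a, b, c, d)"
  shows "nabla4 H (q, \<phi>, p, z) = (a, b, c, d)"
proof -
  \<comment> \<open>Below, \<open>f\<close> varies one slot and freezes the other three, and
    \<open>f'\<close> pads a direction with zeros.\<close>
  have block: "GDERIV (\<lambda>r. H (f r)) r :> g"
    if "(f has_derivative f') (at r)" "f r = (q, \<phi>, p, z)" "\<And>h. f' h \<bullet> (a, b, c, d) = h \<bullet> g"
    for f f' :: "real^'a \<Rightarrow> 'a state4" and r g
    using has_derivative_compose[OF that(1), of H "\<lambda>h. h \<bullet> (a, b, c, d)"] assms that(2,3)
    by (simp add: gderiv_def)
  have "GDERIV (\<lambda>q. H (q, \<phi>, p, z)) q :> a"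
    by (rule block[where f' = "\<lambda>h. (h, 0, 0, 0)"]) (auto intro!: derivative_eq_intros simp: zero_prod_def)
  moreover have "GDERIV (\<lambda>\<phi>. H (q, \<phi>, p, z)) \<phi> :> b"
    by (rule block[where f' = "\<lambda>h. (0, h, 0, 0)"]) (auto intro!: derivative_eq_intros simp: zero_prod_def)
  moreover have "GDERIV (\<lambda>p. H (q, \<phi>, p, z)) p :> c"
    by (rule block[where f' = "\<lambda>h. (0, 0, h, 0)"]) (auto intro!: derivative_eq_intros simp: zero_prod_def)
  moreover have "GDERIV (\<lambda>z. H (q, \<phi>, p, z)) z :> d"
    by (rule block[where f' = "\<lambda>h. (0, 0, 0, h)"]) (auto intro!: derivative_eq_intros simp: zero_prod_def)
  ultimately show ?thesis
    by (simp add: grad_eq)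
qed

text \<open>Joint differentiability makes the column of partial gradients a true gradient, which
  then gives the rate of change of \<open>H\<close> along trajectories.\<close>

lemma GDERIV_nabla4:
  fixes H :: "'n::finite state4 \<Rightarrow> real"
  assumes "H differentiable (at y)"
  shows "GDERIV H y :> nabla4 H y"
proof -
  obtain q \<phi> p z where y: "y = (q, \<phi>, p, z)" by (metis prod.exhaust)
  obtain a b c d where g: "grad H y = (a, b, c, d)" by (metis prod.exhaust)
  have "GDERIV H y :> grad H y" using assms by (rule GDERIV_grad)
  then show ?thesis using nabla4_eq by (metis y g)
qed

section \<open>Port-Hamiltonian systems and their passivity\<close>

lemma port_hamiltonian_nabla4:
  assumes "nabla4 H y = (a, b, c, d)"
  shows "port_hamiltonian De H (\<tau>e, \<tau>u) y =
    (c, d, - a - De *v c + De *v d + \<tau>e, - b + De *v c - De *v d + \<tau>u)"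
  by (simp add: assms matrix_vector_mult_minus)

text \<open>The skew-symmetric part of the structure matrix does no work; the rest dissipates.\<close>

lemma port_hamiltonian_power_balance:
  fixes H :: "'n::finite state4 \<Rightarrow> real"
  assumes "sym_pos_def De" and "nabla4 H y = (a, b, c, d)"
  shows "port_hamiltonian De H (\<tau>e, \<tau>u) y \<bullet> nabla4 H y \<le> c \<bullet> \<tau>e + d \<bullet> \<tau>u"
proof -
  \<comment> \<open>In the power balance the terms with \<open>a\<close> and \<open>b\<close>
    cancel, and the four damping blocks combine into minus this quadratic form.\<close>
  have "0 \<le> (c - d) \<bullet> (De *v (c - d))"
    using assms(1) unfolding sym_pos_def_def by (cases "c - d = 0") (auto intro: less_imp_le)
  then show ?thesis
    unfolding port_hamiltonian_nabla4[OF assms(2)] assms(2)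
    by (simp add: matrix_vector_mult_diff_distrib inner_diff_left inner_diff_right
        inner_add_left inner_commute algebra_simps)
qed

lemma passive_port_hamiltonian:
  fixes H :: "'n::finite state4 \<Rightarrow> real"
  assumes "sym_pos_def De" and "\<And>y. H differentiable (at y)"
  shows "passive_with (port_hamiltonian De H) position_pair H"
  unfolding passive_with_def
proof (intro allI impI ballI)
  fix T and u :: "real \<Rightarrow> (real^'n) \<times> (real^'n)" and y :: "real \<Rightarrow> 'n state4" and t
  assume "solution_on T (port_hamiltonian De H) u y" and "t \<in> T"
  then have y': "(y has_vector_derivative port_hamiltonian De H (u t) (y t)) (at t within T)"
    by (simp add: solution_on_def)
  obtain \<tau>e \<tau>u where u: "u t = (\<tau>e, \<tau>u)" by (metis prod.exhaust)
  obtain a b c d where n: "nabla4 H (y t) = (a, b, c, d)" by (metis prod.exhaust)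
  have pos: "position_pair = (\<lambda>x::'n state4. (fst x, fst (snd x)))"
    by (auto simp: fun_eq_iff)
  have bl: "bounded_linear (position_pair :: 'n state4 \<Rightarrow> _)"
    unfolding pos by (intro bounded_linear_Pair bounded_linear_fst
        bounded_linear_compose[OF bounded_linear_fst bounded_linear_snd])
  \<comment> \<open>The identity blocks in the first two rows make the output equal to
    \<open>(c, d)\<close>, the gradients in \<open>p\<close> and \<open>z\<close> that the power
    balance pairs with the inputs.\<close>
  have "((\<lambda>t. position_pair (y t)) has_vector_derivative (c, d)) (at t within T)"
    using bounded_linear.has_vector_derivative[OF bl y']
    unfolding u port_hamiltonian_nabla4[OF n] by simp
  moreover have "(H has_derivative (\<lambda>h. h \<bullet> nabla4 H (y t))) (at (y t))"
    using GDERIV_nabla4[OF assms(2)] by (simp add: gderiv_def)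
  from vector_derivative_diff_chain_within[OF y' has_derivative_at_withinI[OF this]]
  have "((\<lambda>t. H (y t)) has_real_derivative port_hamiltonian De H (u t) (y t) \<bullet> nabla4 H (y t))
      (at t within T)"
    by (simp add: o_def has_real_derivative_iff_has_vector_derivative)
  moreover have "port_hamiltonian De H (u t) (y t) \<bullet> nabla4 H (y t) \<le> (c, d) \<bullet> u t"
    using port_hamiltonian_power_balance[OF assms(1) n] by (simp add: u)
  ultimately show "\<exists>h r. ((\<lambda>t. H (y t)) has_real_derivative h) (at t within T) \<and>
      ((\<lambda>t. position_pair (y t)) has_vector_derivative r) (at t within T) \<and> h \<le> r \<bullet> u t"
    by blast
qed

section \<open>Change of coordinates along solutions\<close>

text \<open>Since \<open>\<Phi>'\<close> maps one vector field to the other, the chain rule carries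
  solutions forward. Applied to \<open>\<Psi>\<close>, it carries them back.\<close>

lemma solution_on_coordinate_change:
  assumes \<Phi>: "\<And>x. (\<Phi> has_derivative \<Phi>' x) (at x)"
    and \<Psi>: "\<And>y. (\<Psi> has_derivative \<Psi>' y) (at y)"
    and inverse: "\<And>x. \<Psi> (\<Phi> x) = x"
    and field: "\<And>u x. \<Phi>' x (f u x) = g u (\<Phi> x)"
  shows "solution_on T f u x \<longleftrightarrow> solution_on T g u (\<lambda>t. \<Phi> (x t))"
proof
  assume *: "solution_on T f u x"
  show "solution_on T g u (\<lambda>t. \<Phi> (x t))"
    unfolding solution_on_def
  proof
    fix t assume "t \<in> T"
    with * have "(x has_vector_derivative f (u t) (x t)) (at t within T)"
      by (simp add: solution_on_def)
    from vector_derivative_diff_chain_within[OF this has_derivative_at_withinI[OF \<Phi>]]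
    show "((\<lambda>t. \<Phi> (x t)) has_vector_derivative g (u t) (\<Phi> (x t))) (at t within T)"
      by (simp add: o_def field)
  qed
next
  assume *: "solution_on T g u (\<lambda>t. \<Phi> (x t))"
  \<comment> \<open>Differentiating \<open>\<Psi> (\<Phi> x) = x\<close> shows that
    \<open>\<Psi>'\<close> recovers the original vector field.\<close>
  have left_inverse: "\<Psi>' (\<Phi> x) (\<Phi>' x h) = h" for x h
  proof -
    have "((\<lambda>x. \<Psi> (\<Phi> x)) has_derivative (\<lambda>h. \<Psi>' (\<Phi> x) (\<Phi>' x h))) (at x)"
      by (rule has_derivative_compose[OF \<Phi> \<Psi>])
    moreover have "((\<lambda>x. \<Psi> (\<Phi> x)) has_derivative (\<lambda>h. h)) (at x)"
      by (simp add: inverse)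
    ultimately show ?thesis using has_derivative_unique by metis
  qed
  show "solution_on T f u x"
    unfolding solution_on_def
  proof
    fix t assume "t \<in> T"
    with * have "((\<lambda>t. \<Phi> (x t)) has_vector_derivative \<Phi>' (x t) (f (u t) (x t))) (at t within T)"
      by (simp add: solution_on_def field)
    from vector_derivative_diff_chain_within[OF this has_derivative_at_withinI[OF \<Psi>]]
    show "(x has_vector_derivative f (u t) (x t)) (at t within T)"
      by (simp add: o_def left_inverse inverse)
  qed
qed

text \<open>Both \<^const>\<open>coord_change\<close> and its inverse are of the following form, with
  \<open>N\<close> the inverse mass matrix.\<close>

fun shear ::
  "(real^'n \<Rightarrow> real^'n^'n) \<Rightarrow> real^'n^'n \<Rightarrow> real^'n^'n \<Rightarrow> real^'n^'n \<Rightarrow> real^'n^'n \<Rightarrow>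
   'n state4 \<Rightarrow> 'n state4" where
  "shear N A B E F (q, \<theta>, p, s) = (q, A *v q + B *v \<theta>, p, E *v (N q *v p) + F *v s)"

fun shear_derivative ::
  "(real^'n \<Rightarrow> real^'n^'n) \<Rightarrow> (real^'n \<Rightarrow> real^'n \<Rightarrow> real^'n^'n) \<Rightarrow>
   real^'n^'n \<Rightarrow> real^'n^'n \<Rightarrow> real^'n^'n \<Rightarrow> real^'n^'n \<Rightarrow> 'n state4 \<Rightarrow> 'n state4 \<Rightarrow> 'n state4" where
  "shear_derivative N N' A B E F (q, \<theta>, p, s) (hq, h\<theta>, hp, hs) =
     (hq, A *v hq + B *v h\<theta>, hp, E *v (N q *v hp + N' q hq *v p) + F *v hs)"

lemma has_derivative_shear:
  assumes N: "\<And>q. (N has_derivative N' q) (at q)"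
  shows "(shear N A B E F has_derivative shear_derivative N N' A B E F x) (at x)"
proof -
  have eq: "shear N A B E F = (\<lambda>x. (fst x, A *v fst x + B *v fst (snd x), fst (snd (snd x)),
      E *v (N (fst x) *v fst (snd (snd x))) + F *v snd (snd (snd x))))"
    by (auto simp: fun_eq_iff)
  have eq': "shear_derivative N N' A B E F x = (\<lambda>h. (fst h, A *v fst h + B *v fst (snd h),
      fst (snd (snd h)), E *v (N (fst x) *v fst (snd (snd h)) + N' (fst x) (fst h) *v fst (snd (snd x)))
        + F *v snd (snd (snd h))))"
    by (cases x) (auto simp: fun_eq_iff)
  note intros = bounded_linear.has_derivative[OF matrix_vector_mul_bounded_linear]
    has_derivative_matrix_vector_mult has_derivative_compose[OF _ N]
  show ?thesis
    unfolding eq eq' by (intro derivative_intros intros)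
qed

lemma continuously_differentiable_shear:
  assumes N: "\<And>q. (N has_derivative N' q) (at q)"
    and N': "\<And>h. continuous_on UNIV (\<lambda>q. N' q h)"
  shows "continuously_differentiable (shear N A B E F)"
proof (rule continuously_differentiableI)
  fix h :: "'a state4"
  obtain hq h\<theta> hp hs where h: "h = (hq, h\<theta>, hp, hs)" by (metis prod.exhaust)
  have eq: "(\<lambda>x. shear_derivative N N' A B E F x h) = (\<lambda>x. (hq, A *v hq + B *v h\<theta>, hp,
      E *v (N (fst x) *v hp + N' (fst x) hq *v fst (snd (snd x))) + F *v hs))"
    by (auto simp: fun_eq_iff h)
  have "continuous_on UNIV N"
    using N by (auto intro!: continuous_at_imp_continuous_on has_derivative_continuous)
  show "continuous_on UNIV (\<lambda>x. shear_derivative N N' A B E F x h)"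
    unfolding eq
    by (intro continuous_intros continuous_on_matrix_vector_mult
       continuous_on_compose2[OF \<open>continuous_on UNIV N\<close>] continuous_on_compose2[OF N']) auto
qed (rule has_derivative_shear[OF N])

section \<open>Derivatives of the energies\<close>

lemma grad_quadratic_form:
  fixes A :: "'a::euclidean_space \<Rightarrow> real^'n^'n"
  assumes "(A has_derivative A') (at q)"
  shows "h \<bullet> grad (\<lambda>q. v \<bullet> (A q *v v)) q = v \<bullet> (A' h *v v)"
proof -
  have "((\<lambda>q. A q *v v) has_derivative (\<lambda>h. A' h *v v)) (at q)"
    using has_derivative_matrix_vector_mult[OF assms has_derivative_const[of v]] by simp
  from has_derivative_inner_right[OF this, of v]
  have d: "((\<lambda>q. v \<bullet> (A q *v v)) has_derivative (\<lambda>h. v \<bullet> (A' h *v v))) (at q)" .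
  then have "GDERIV (\<lambda>q. v \<bullet> (A q *v v)) q :> grad (\<lambda>q. v \<bullet> (A q *v v)) q"
    by (intro GDERIV_grad) (auto simp: differentiable_def)
  then show ?thesis
    using fun_cong[OF has_derivative_unique[OF d], of _ h] by (simp add: gderiv_def)
qed

text \<open>By linearity, the partial derivatives weighted with the components of \<open>v\<close>
  add up to the derivative in direction \<open>v\<close>.\<close>

lemma mass_derivative_eq:
  assumes "(M has_derivative M') (at q)"
  shows "mass_derivative M q v = M' v"
proof -
  have lin: "linear M'" using assms by (rule has_derivative_linear)
  have "M' v = M' (\<Sum>i\<in>UNIV. v $ i *\<^sub>R axis i 1)"
    using basis_expansion[of v] by (simp add: scalar_mult_eq_scaleR)
  then show ?thesis
    by (simp add: mass_derivative_def partial_derivative_eq[OF assms] linear_sum[OF lin]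
        linear_cmul[OF lin])
qed

text \<open>The derivative of the inverse is minus the derivative of \<open>M\<close> between two
  factors \<open>matrix_inv (M q)\<close>. By symmetry these factors move onto the two copies of
  \<open>p\<close> and turn them into the velocity.\<close>

lemma grad_inverse_mass:
  fixes M :: "real^'n \<Rightarrow> real^'n^'n"
  assumes spd: "\<And>q. sym_pos_def (M q)" and M: "(M has_derivative M') (at q)"
  shows "grad (\<lambda>q. p \<bullet> (matrix_inv (M q) *v p)) q =
    - grad (\<lambda>r. (matrix_inv (M q) *v p) \<bullet> (M r *v (matrix_inv (M q) *v p))) q"
    (is "?l = - ?r")
proof -
  note N = has_derivative_matrix_inv[OF M invertible_sym_pos_def[OF spd]]
  have "h \<bullet> ?l = h \<bullet> - ?r" for h
    unfolding inner_minus_right grad_quadratic_form[OF N] grad_quadratic_form[OF M]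
    by (simp add: matrix_vector_mul_assoc[symmetric] matrix_vector_mult_minus
        sym_pos_def_inv_inner[OF spd, symmetric])
  then show ?thesis using vector_eq_ldot by blast
qed

text \<open>The gradient is assembled term by term. The spring energy depends on
  \<open>\<phi> - q\<close> only, so its force enters the first two components with opposite
  signs.\<close>

lemma GDERIV_H_NCL:
  fixes M :: "real^'n \<Rightarrow> real^'n^'n"
  assumes spd: "\<And>q. sym_pos_def (M q)" and M: "(M has_derivative M') (at q)"
    and V: "V differentiable (at q)" and Je: "sym_pos_def Je" and Ke: "sym_pos_def Ke"
  shows "GDERIV (H_NCL M V Je Ke) (q, \<phi>, p, z) :>
    ((1/2) *\<^sub>R grad (\<lambda>q. p \<bullet> (matrix_inv (M q) *v p)) q - Ke *v (\<phi> - q) + grad V q,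
     Ke *v (\<phi> - q), matrix_inv (M q) *v p, matrix_inv Je *v z)"
proof -
  define y where "y = (q, \<phi>, p, z)"
  define N where "N q = matrix_inv (M q)" for q
  define N' where "N' h = - (N q ** M' h ** N q)" for h
  have N: "(N has_derivative N') (at (fst y))"
    using has_derivative_matrix_inv[OF M invertible_sym_pos_def[OF spd]]
    by (simp add: N_def[abs_def] N'_def[abs_def] y_def)
  have symN: "(N r *v x) \<bullet> x' = x \<bullet> (N r *v x')" for r x x'
    unfolding N_def by (rule sym_pos_def_inv_inner[OF spd])
  have eq: "H_NCL M V Je Ke = (\<lambda>y. (1/2) * (fst (snd (snd y)) \<bullet> (N (fst y) *v fst (snd (snd y))))
      + (1/2) * (snd (snd (snd y)) \<bullet> (matrix_inv Je *v snd (snd (snd y))))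
      + (1/2) * ((fst (snd y) - fst y) \<bullet> (Ke *v (fst (snd y) - fst y))) + V (fst y))"
    by (auto simp: fun_eq_iff N_def)
  \<comment> \<open>Fixing the inner map to the projection leaves unification a single way to
    decompose a function of the position.\<close>
  note compose_fst = has_derivative_compose[of fst fst y UNIV,
      OF has_derivative_fst[OF has_derivative_ident]]
  have kinetic: "((\<lambda>y. (1/2) * (fst (snd (snd y)) \<bullet> (N (fst y) *v fst (snd (snd y)))))
      has_derivative (\<lambda>h. (1/2) * (fst (snd (snd y)) \<bullet> (N (fst y) *v fst (snd (snd h))
          + N' (fst h) *v fst (snd (snd y))) + fst (snd (snd h)) \<bullet> (N (fst y) *v fst (snd (snd y))))))
      (at y)"
    by (intro derivative_intros has_derivative_matrix_vector_mult compose_fst N)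
  have motor: "((\<lambda>y. (1/2) * (snd (snd (snd y)) \<bullet> (matrix_inv Je *v snd (snd (snd y)))))
      has_derivative (\<lambda>h. snd (snd (snd h)) \<bullet> (matrix_inv Je *v snd (snd (snd y))))) (at y)"
    by (intro has_derivative_quadratic_form sym_pos_def_inv_inner Je derivative_intros)
  have spring: "((\<lambda>y. (1/2) * ((fst (snd y) - fst y) \<bullet> (Ke *v (fst (snd y) - fst y))))
      has_derivative (\<lambda>h. (fst (snd h) - fst h) \<bullet> (Ke *v (fst (snd y) - fst y)))) (at y)"
    by (intro has_derivative_quadratic_form sym_pos_def_inner Ke derivative_intros)
  have potential: "((\<lambda>y. V (fst y)) has_derivative (\<lambda>h. fst h \<bullet> grad V q)) (at y)"
    using GDERIV_grad[OF V] by (intro compose_fst) (simp add: gderiv_def y_def)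
  have grad: "h \<bullet> grad (\<lambda>q. p \<bullet> (N q *v p)) q = p \<bullet> (N' h *v p)" for h
    using N by (intro grad_quadratic_form) (simp add: y_def)
  \<comment> \<open>The two terms obtained by varying \<open>p\<close> coincide, which absorbs the
    factor 1/2.\<close>
  have sym: "p \<bullet> (N q *v x) = x \<bullet> (N q *v p)" for x
    by (metis symN inner_commute)
  have "(H_NCL M V Je Ke has_derivative (\<lambda>h. h \<bullet>
    ((1/2) *\<^sub>R grad (\<lambda>q. p \<bullet> (N q *v p)) q - Ke *v (\<phi> - q) + grad V q,
     Ke *v (\<phi> - q), N q *v p, matrix_inv Je *v z))) (at y)"
    unfolding eq
    by (rule has_derivative_eq_rhs[OF has_derivative_add[OF has_derivative_add[OF
          has_derivative_add[OF kinetic motor] spring] potential]])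
       (auto simp: fun_eq_iff y_def grad sym inner_add_left inner_add_right inner_diff_left
          inner_diff_right algebra_simps)
  then show ?thesis
    by (simp add: gderiv_def N_def y_def)
qed

section \<open>The closed loop in the new coordinates\<close>

lemma coord_change_eq_shear:
  "coord_change M J K Je Ke = shear (\<lambda>q. matrix_inv (M q)) (matrix_inv Ke ** (Ke - K))
     (matrix_inv Ke ** K) (Je ** matrix_inv Ke ** (Ke - K)) (Je ** matrix_inv Ke ** K ** matrix_inv J)"
  by (auto simp: fun_eq_iff matrix_vector_mul_assoc)

lemmas expand_matrix_vector =
  matrix_vector_mul_assoc[symmetric] matrix_vector_mult_minus
  matrix_vector_right_distrib matrix_vector_mult_diff_distrib
  matrix_vector_mult_add_rdistrib matrix_vector_mult_diff_rdistrib
  matrix_vector_mult_scaleR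

text \<open>The coefficients come from solving the second component for \<open>\<theta>\<close>. As
  \<open>z\<close> is \<open>Je\<close> times the velocity of \<open>\<phi>\<close>, the velocities
  obey the same linear relation, so these coefficients recur in the last component, scaled by
  \<open>J\<close> and \<open>matrix_inv Je\<close>.\<close>

lemma shear_inverse:
  fixes M :: "real^'n \<Rightarrow> real^'n^'n"
  assumes "sym_pos_def J" "sym_pos_def K" "sym_pos_def Je" "sym_pos_def Ke"
  defines "\<Psi> \<equiv> shear (\<lambda>q. matrix_inv (M q)) (mat 1 - matrix_inv K ** Ke) (matrix_inv K ** Ke)
    (J ** (mat 1 - matrix_inv K ** Ke)) (J ** matrix_inv K ** Ke ** matrix_inv Je)"
  shows "\<Psi> (coord_change M J K Je Ke x) = x" "coord_change M J K Je Ke (\<Psi> y) = y"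
  using assms(1-4) unfolding \<Psi>_def
  by (cases x; cases y; simp add: expand_matrix_vector)+

text \<open>The relative velocity of \<open>\<theta>\<close> and \<open>q\<close> is
  \<open>matrix_inv K ** Ke\<close> times that of \<open>\<phi>\<close> and \<open>q\<close>, which
  explains the form of \<open>De\<close>. In the last row the terms with \<open>gain_F\<close>,
  including the one inside \<open>gain_G\<close>, cancel the contribution of the link acceleration.
  \<open>gain_H\<close> inverts the factor in front of the derivative of \<open>s\<close>, and the
  \<open>mat 1\<close> in \<open>gain_G\<close> offsets the coupling force in the plant.\<close>

lemma shear_derivative_closed_loop:
  fixes M :: "real^'n \<Rightarrow> real^'n^'n"
  assumes spd: "\<And>q. sym_pos_def (M q)" and M: "\<And>q. (M has_derivative M' q) (at q)"
    and V: "\<And>q. V differentiable (at q)" and C: "coriolis_matrix M C"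
    and pos: "sym_pos_def J" "sym_pos_def K" "sym_pos_def Je" "sym_pos_def Ke"
    and De: "De = D ** matrix_inv K ** Ke"
  shows "shear_derivative (\<lambda>q. matrix_inv (M q))
      (\<lambda>q h. - (matrix_inv (M q) ** M' q h ** matrix_inv (M q)))
      (matrix_inv Ke ** (Ke - K)) (matrix_inv Ke ** K)
      (Je ** matrix_inv Ke ** (Ke - K)) (Je ** matrix_inv Ke ** K ** matrix_inv J) x
      (closed_loop M C J K D V Je Ke u x) =
    port_hamiltonian De (H_NCL M V Je Ke) u (coord_change M J K Je Ke x)"
proof -
  obtain q \<theta> p s where x: "x = (q, \<theta>, p, s)" by (metis prod.exhaust)
  obtain \<tau>e \<tau>u where u: "u = (\<tau>e, \<tau>u)" by (metis prod.exhaust)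
  define v where "v = matrix_inv (M q) *v p"
  \<comment> \<open>The link acceleration is \<open>matrix_inv (M q)\<close> applied to the
    derivative of \<open>p\<close> minus \<open>M' q v *v v\<close>. By \<open>grad\<close> the
    first of these contains the same half gradient, so the difference retains only the Coriolis
    term.\<close>
  have mass: "M' q v *v v = C q v *v v + (1/2) *\<^sub>R grad (\<lambda>q. v \<bullet> (M q *v v)) q"
    using C by (simp add: coriolis_matrix_def mass_derivative_eq[OF M])
  have grad: "grad (\<lambda>q. p \<bullet> (matrix_inv (M q) *v p)) q = - grad (\<lambda>q. v \<bullet> (M q *v v)) q"
    unfolding v_def by (rule grad_inverse_mass[OF spd M])
  note nabla = nabla4_eq[OF GDERIV_H_NCL[OF spd M V pos(3,4)]]
  show ?thesis
    unfolding x u De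
    by (simp del: port_hamiltonian.simps add: port_hamiltonian_nabla4[OF nabla] control_law_def Let_def
        gain_F_def gain_G_def gain_H_def v_def[symmetric] mass grad expand_matrix_vector pos)
qed

text \<open>The change of dynamics is expressed as an equivalence between solutions, so no
  trajectory is lost or added. For passivity, storage function and outputs are pulled back to the
  original state.\<close>

theorem proposition2:
  fixes M :: "real^'n \<Rightarrow> real^'n^'n"
    and C :: "real^'n \<Rightarrow> real^'n \<Rightarrow> real^'n^'n"
    and J K D Je Ke De :: "real^'n^'n"
    and V :: "real^'n \<Rightarrow> real"
  assumes "continuously_differentiable M"
    and "\<And>q. sym_pos_def (M q)"
    and "sym_pos_def J" and "sym_pos_def K" and "sym_pos_def D"
    and "\<And>q. V differentiable (at q)"
    and "coriolis_matrix M C"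
    and "sym_pos_def Je" and "sym_pos_def Ke"
    and "De = D ** matrix_inv K ** Ke" and "sym_pos_def De"
  shows "C1_diffeomorphism (coord_change M J K Je Ke)
    \<and> (\<forall>T \<tau>e \<tau>u x. time_interval T \<longrightarrow>
         (solution_on T (closed_loop M C J K D V Je Ke) (\<lambda>t. (\<tau>e t, \<tau>u t)) x \<longleftrightarrow>
          solution_on T (port_hamiltonian De (H_NCL M V Je Ke)) (\<lambda>t. (\<tau>e t, \<tau>u t))
            (\<lambda>t. coord_change M J K Je Ke (x t))))
    \<and> passive_with (closed_loop M C J K D V Je Ke)
         (\<lambda>x. position_pair (coord_change M J K Je Ke x))
         (\<lambda>x. H_NCL M V Je Ke (coord_change M J K Je Ke x))"
proof -
  let ?\<Phi> = "coord_change M J K Je Ke"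
  let ?N = "\<lambda>q. matrix_inv (M q)"
  obtain M' where M: "\<And>q. (M has_derivative blinfun_apply (M' q)) (at q)"
    and M': "continuous_on UNIV M'"
    using assms(1) unfolding continuously_differentiable_def by blast
  let ?N' = "\<lambda>q h. - (?N q ** M' q h ** ?N q)"
  have N: "(?N has_derivative ?N' q) (at q)" for q
    by (rule has_derivative_matrix_inv[OF M invertible_sym_pos_def[OF assms(2)]])
  have "continuous_on UNIV ?N"
    using N by (auto intro!: continuous_at_imp_continuous_on has_derivative_continuous)
  \<comment> \<open>Continuity of the derivative of \<open>M\<close> enters here and makes the
    coordinate change and its inverse continuously differentiable.\<close>
  then have N': "continuous_on UNIV (\<lambda>q. ?N' q h)" for h
    by (intro continuous_intros continuous_on_matrix_matrix_mult
        bounded_bilinear.continuous_on[OF bounded_bilinear_blinfun_apply] M')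
  define \<Psi> where "\<Psi> = shear ?N (mat 1 - matrix_inv K ** Ke) (matrix_inv K ** Ke)
    (J ** (mat 1 - matrix_inv K ** Ke)) (J ** matrix_inv K ** Ke ** matrix_inv Je)"
  have \<Psi>: "\<Psi> (?\<Phi> x) = x" "?\<Phi> (\<Psi> x) = x" for x
    unfolding \<Psi>_def by (rule shear_inverse[OF assms(3,4,8,9)])+
  note \<Phi>_deriv = has_derivative_shear[OF N, of "matrix_inv Ke ** (Ke - K)" "matrix_inv Ke ** K"
      "Je ** matrix_inv Ke ** (Ke - K)" "Je ** matrix_inv Ke ** K ** matrix_inv J",
      folded coord_change_eq_shear[of M J K Je Ke]]
  note field = shear_derivative_closed_loop[OF assms(2) M assms(6,7,3,4,8,9,10)]
  have "bij ?\<Phi>" using \<Psi> by (metis bijI')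
  moreover have "inv ?\<Phi> = \<Psi>" using \<Psi> by (intro inv_equality)
  ultimately have diffeo: "C1_diffeomorphism ?\<Phi>"
    using continuously_differentiable_shear[OF N N']
    unfolding C1_diffeomorphism_def by (simp add: \<Psi>_def coord_change_eq_shear)
  have solution: "solution_on T (closed_loop M C J K D V Je Ke) u x \<longleftrightarrow>
      solution_on T (port_hamiltonian De (H_NCL M V Je Ke)) u (\<lambda>t. ?\<Phi> (x t))" for T u x
    by (rule solution_on_coordinate_change[OF \<Phi>_deriv has_derivative_shear[OF N]
        \<Psi>(1)[unfolded \<Psi>_def] field])
  have "H_NCL M V Je Ke differentiable (at y)" for y
    using GDERIV_H_NCL[OF assms(2) M assms(6,8,9)]
    unfolding gderiv_def differentiable_def by (cases y) blast
  \<comment> \<open>Passivity quantifies over solutions, so the equivalence \<open>solution\<close>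
    transfers it to the original coordinates.\<close>
  from passive_port_hamiltonian[OF assms(11) this]
  have "passive_with (closed_loop M C J K D V Je Ke) (\<lambda>x. position_pair (?\<Phi> x))
      (\<lambda>x. H_NCL M V Je Ke (?\<Phi> x))"
    unfolding passive_with_def solution by blast
  with diffeo solution show ?thesis by blast
qed

end
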